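(* Let $d\ge 2$ and let $\mathbf{k}:\mathbb{R}^d\to\mathbb{R}^{d\times d}$ be an arbitrary matrix-valued function. The following are equivalent: (i) for every $x\in\mathbb{R}^d$ and every $R\in O(\mathbb{R}^d)$ one has $\mathbf{k}(-x)=\mathbf{k}(x)^T$ and $\mathbf{k}(Rx)=R\,\mathbf{k}(x)R^{-1}$; (ii) there exist a scalar $k_0\in\mathbb{R}$ such that $\mathbf{k}(0)=k_0\mathbb{I}_d$ and two functions $k^\parallel,k^\perp:\mathbb{R}^+\to\mathbb{R}$ such that for all $x\in\mathbb{R}^d$, $x\neq0$, $$\mathbf{k}(x)=k^\parallel(\|x\|)\,\mathrm{Pr}_x^\parallel+k^\perp(\|x\|)\,\mathrm{Pr}_x^\perp .$$
   Context: $\mathbb{R}^+=(0,\infty)$; $\|\cdot\|$ is the Euclidean norm; $O(\mathbb{R}^d)$ is the full orthogonal group; $\mathbb{I}_d$ is the $d\times d$ identity matrix. For $x\in\mathbb{R}^d\setminus\{0\}$, $\mathrm{Pr}_x^\parallel:=xx^T/\|x\|^2$ and $\mathrm{Pr}_x^\perp:=\mathbb{I}_d-xx^T/\|x\|^2$. *)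

theory Defs
  imports "HOL-Analysis.Analysis"
begin

text \<open>The matrix \<open>x x\<^sup>T\<close>.\<close>

definition outer :: "real ^ 'd \<Rightarrow> real ^ 'd ^ 'd" where
  "outer x = (\<chi> i j. x $ i * x $ j)"

text \<open>The two projections are meant for \<open>x \<noteq> 0\<close> only; at \<open>0\<close> the convention
  \<open>1 / 0 = 0\<close> gives values that should not be used.\<close>

definition Pr_par :: "real ^ 'd \<Rightarrow> real ^ 'd ^ 'd" where
  "Pr_par x = (1 / (norm x)\<^sup>2) *\<^sub>R outer x"

definition Pr_perp :: "real ^ 'd \<Rightarrow> real ^ 'd ^ 'd" where
  "Pr_perp x = mat 1 - (1 / (norm x)\<^sup>2) *\<^sub>R outer x"

end

theory Submission
  imports Defs
begin

text \<open>If \<open>k\<close> is equivariant, \<open>k y\<close> commutes with the stabilizer of \<open>y\<close>, in particular with the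
  reflections along the vectors \<open>v\<close> orthogonal to \<open>y\<close>. Hence every such \<open>v\<close> is an eigenvector; since
  the reflection along \<open>w - v\<close> swaps \<open>v\<close> and \<open>w\<close> of equal norm, the eigenvalue is the same for all of
  them, and \<open>y\<close> is an eigenvector because its image is orthogonal to each \<open>v\<close>. The case \<open>y = 0\<close> is
  included. Transporting the resulting form from a fixed ray by rotations makes the two
  coefficients depend on the norm only.\<close>

lemma Pr_par_mult: "Pr_par x *v z = ((x \<bullet> z) / (norm x)\<^sup>2) *\<^sub>R x"
  by (simp add: vec_eq_iff Pr_par_def outer_def matrix_vector_mult_def inner_vec_def
      sum_distrib_left sum_divide_distrib mult_ac flip: sum_distrib_right)

lemma Pr_perp_eq: "Pr_perp x = mat 1 - Pr_par x"
  by (simp add: Pr_perp_def Pr_par_def)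

lemma Pr_perp_mult: "Pr_perp x *v z = z - ((x \<bullet> z) / (norm x)\<^sup>2) *\<^sub>R x"
  by (simp add: Pr_perp_eq matrix_vector_mult_diff_rdistrib Pr_par_mult)

lemma transpose_Pr_par: "transpose (Pr_par x) = Pr_par x"
  by (simp add: vec_eq_iff transpose_def Pr_par_def outer_def mult.commute)

lemma Pr_par_minus: "Pr_par (- x) = Pr_par x"
  by (simp add: vec_eq_iff Pr_par_def outer_def)

lemma Pr_par_0: "Pr_par 0 = 0"
  by (simp add: Pr_par_def)

lemma orthogonal_matrix_inner:
  fixes R :: "real ^ 'n ^ 'n"
  assumes "orthogonal_matrix R"
  shows "(R *v x) \<bullet> (R *v y) = x \<bullet> y"
  using assms orthogonal_transformation_matrix[of "(*v) R"]
  by (simp add: orthogonal_transformation_def)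

lemma orthogonal_matrix_norm:
  fixes R :: "real ^ 'n ^ 'n"
  assumes "orthogonal_matrix R"
  shows "norm (R *v x) = norm x"
  using orthogonal_matrix_inner[OF assms, of x x] by (simp add: norm_eq_sqrt_inner)

lemma matrix_inv_orthogonal:
  fixes R :: "real ^ 'n ^ 'n"
  assumes "orthogonal_matrix R"
  shows "matrix_inv R = transpose R"
proof -
  have "invertible R"
    using assms by (auto simp: invertible_def orthogonal_matrix_def)
  then have "R ** matrix_inv R = mat 1"
    unfolding invertible_def matrix_inv_def by (rule someI2_ex) blast
  then have "(transpose R ** R) ** matrix_inv R = transpose R"
    by (simp flip: matrix_mul_assoc)
  with assms show ?thesis
    by (simp add: orthogonal_matrix_def)
qed

text \<open>Multiplying by \<open>R\<close> on the right removes the inverse, so equivariance can be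
  tested vector by vector.\<close>

lemma conj_eq_iff_intertwines:
  fixes R :: "real ^ 'n ^ 'n"
  assumes "orthogonal_matrix R"
  shows "B = R ** A ** matrix_inv R \<longleftrightarrow> (\<forall>z. B *v (R *v z) = R *v (A *v z))"
proof -
  have *: "transpose R ** R = mat 1" "R ** transpose R = mat 1"
    using assms by (auto simp: orthogonal_matrix_def)
  have "B = R ** A ** transpose R \<longleftrightarrow> B ** R = R ** A"
    using * by (metis matrix_mul_assoc matrix_mul_rid)
  then show ?thesis
    by (simp add: matrix_inv_orthogonal[OF assms] matrix_eq matrix_vector_mul_assoc)
qed

lemma reflection_mult:
  "(mat 1 - 2 *\<^sub>R Pr_par v) *v z = z - (2 * (v \<bullet> z) / (norm v)\<^sup>2) *\<^sub>R v"
  by (simp add: matrix_vector_mult_diff_rdistrib Pr_par_mult flip: scaleR_matrix_vector_assoc)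

text \<open>A hyperplane reflection is symmetric and an involution, hence its own transpose inverse.
  For \<open>v = 0\<close> the matrix is the identity, because \<open>Pr_par 0 = 0\<close>.\<close>

lemma orthogonal_matrix_reflection:
  fixes v :: "real ^ 'n"
  shows "orthogonal_matrix (mat 1 - 2 *\<^sub>R Pr_par v)"
proof -
  let ?R = "mat 1 - 2 *\<^sub>R Pr_par v"
  have "transpose ?R = ?R"
    by (simp add: vec_eq_iff transpose_def Pr_par_def outer_def mult.commute mat_def)
  moreover have "?R *v (?R *v z) = z" for z
  proof (cases "v = 0")
    case False
    define t where "t = 2 * (v \<bullet> z) / (norm v)\<^sup>2"
    have "v \<bullet> (z - t *\<^sub>R v) = - (v \<bullet> z)"
      using False by (simp add: t_def inner_diff_right power2_norm_eq_inner)
    then show ?thesis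
      by (simp add: reflection_mult t_def)
  qed (simp add: reflection_mult)
  ultimately show ?thesis
    by (simp add: orthogonal_matrix matrix_eq flip: matrix_vector_mul_assoc)
qed

text \<open>At \<open>y = 0\<close> the stabilizer is the whole orthogonal group, and the conclusion
  then says that \<open>A\<close> is the scalar matrix \<open>b *\<^sub>R mat 1\<close>.\<close>

lemma commutes_with_stabilizer:
  fixes A :: "real ^ 'n ^ 'n"
  assumes comm: "\<And>R z. orthogonal_matrix R \<Longrightarrow> R *v y = y \<Longrightarrow> A *v (R *v z) = R *v (A *v z)"
  obtains a b where "A = a *\<^sub>R Pr_par y + b *\<^sub>R Pr_perp y"
proof -
  have reflect: "A *v (z - (2 * (v \<bullet> z) / (norm v)\<^sup>2) *\<^sub>R v)
      = A *v z - (2 * (v \<bullet> (A *v z)) / (norm v)\<^sup>2) *\<^sub>R v" if "v \<bullet> y = 0" for v z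
    using comm[OF orthogonal_matrix_reflection, of v z] that by (simp add: reflection_mult)
  have perp_eigen: "A *v v = ((v \<bullet> (A *v v)) / (norm v)\<^sup>2) *\<^sub>R v" if "v \<bullet> y = 0" for v
  proof (cases "v = 0")
    case False
    \<comment> \<open>The reflection along \<open>v\<close> negates \<open>v\<close>. Commuting it
      past \<open>A\<close> shows that \<open>A *v v\<close> equals its own projection onto
      \<open>v\<close>.\<close>
    then have "v - (2 * (v \<bullet> v) / (norm v)\<^sup>2) *\<^sub>R v = - v"
      by (simp add: power2_norm_eq_inner scaleR_2)
    then have "A *v v - (2 * (v \<bullet> (A *v v)) / (norm v)\<^sup>2) *\<^sub>R v = A *v (- v)"
      using reflect[OF that, of v] by (simp only:)
    also have "\<dots> = - (A *v v)"
      using matrix_vector_mult_scaleR[of A "-1" v] by simp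
    finally have "2 *\<^sub>R (A *v v) = (2 * (v \<bullet> (A *v v)) / (norm v)\<^sup>2) *\<^sub>R v"
      unfolding scaleR_2 by (simp add: diff_eq_eq flip: eq_diff_eq')
    also have "\<dots> = 2 *\<^sub>R (((v \<bullet> (A *v v)) / (norm v)\<^sup>2) *\<^sub>R v)"
      by simp
    finally show ?thesis
      by (simp only: scaleR_cancel_left) simp
  qed simp
  obtain b where b: "A *v v = b *\<^sub>R v" if "v \<bullet> y = 0" for v
  proof (cases "\<exists>u. u \<noteq> 0 \<and> u \<bullet> y = 0")
    case True
    then obtain u where u: "u \<noteq> 0" "u \<bullet> y = 0" by blast
    define c where "c = (u \<bullet> (A *v u)) / (norm u)\<^sup>2"
    have Au: "A *v u = c *\<^sub>R u"
      using perp_eigen[OF u(2)] by (simp add: c_def)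
    have "A *v v = c *\<^sub>R v" if v: "v \<bullet> y = 0" for v
    proof -
      \<comment> \<open>Rescaling \<open>u\<close> to the norm of \<open>v\<close> keeps its
        eigenvalue \<open>c\<close> and makes the reflection along \<open>w - v\<close> send
        \<open>w\<close> to \<open>v\<close>.\<close>
      define w where "w = (norm v / norm u) *\<^sub>R u"
      have w: "w \<bullet> y = 0" "norm w = norm v" "A *v w = c *\<^sub>R w"
        using u Au by (simp_all add: w_def matrix_vector_mult_scaleR)
      show ?thesis
      proof (cases "w = v")
        case False
        have nw: "w \<bullet> w = v \<bullet> v"
          using w(2) by (simp add: norm_eq)
        have "2 * ((w - v) \<bullet> w) = (norm (w - v))\<^sup>2"
          using nw by (simp add: power2_norm_eq_inner algebra_simps inner_commute)
        then have swap: "2 * ((w - v) \<bullet> w) / (norm (w - v))\<^sup>2 = 1"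
          using False by simp
        \<comment> \<open>Once the coefficient is 1, the left side is \<open>A *v v\<close> and the
          right side is \<open>c *\<^sub>R w - c *\<^sub>R (w - v)\<close>.\<close>
        have "A *v (w - (2 * ((w - v) \<bullet> w) / (norm (w - v))\<^sup>2) *\<^sub>R (w - v))
          = c *\<^sub>R w - (c * (2 * ((w - v) \<bullet> w) / (norm (w - v))\<^sup>2)) *\<^sub>R (w - v)"
          using reflect[of "w - v" w] w v by (simp add: inner_diff_left mult_ac)
        then show ?thesis
          unfolding swap by (simp add: algebra_simps)
      qed (use w in simp)
    qed
    then show ?thesis by (rule that)
  next
    case False
    \<comment> \<open>Only the zero vector is orthogonal to \<open>y\<close> here, so the eigenvalue
      0 is an arbitrary choice.\<close>
    have "A *v v = 0 *\<^sub>R v" if "v \<bullet> y = 0" for v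
    proof -
      have "v = 0"
        using False that by blast
      then show ?thesis by simp
    qed
    then show ?thesis by (rule that)
  qed
  \<comment> \<open>The Rayleigh quotient of \<open>A\<close> at \<open>y\<close>: it makes
    \<open>A *v y - a *\<^sub>R y\<close> orthogonal to \<open>y\<close>.\<close>
  define a where "a = (y \<bullet> (A *v y)) / (norm y)\<^sup>2"
  have par: "A *v y = a *\<^sub>R y"
  proof (cases "y = 0")
    case False
    define w where "w = A *v y - a *\<^sub>R y"
    have wy: "w \<bullet> y = 0"
      using False by (simp add: w_def a_def inner_diff_left inner_diff_right
          power2_norm_eq_inner inner_commute)
    \<comment> \<open>The reflection along \<open>w\<close> fixes \<open>y\<close>, hence also
      \<open>A *v y\<close>, which is therefore orthogonal to \<open>w\<close>.\<close>
    have "w \<bullet> (A *v y) = 0"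
      using reflect[OF wy, of y] wy by auto
    then have "w \<bullet> w = 0"
      using wy by (simp add: w_def inner_diff_right)
    then show ?thesis
      by (simp add: w_def)
  qed simp
  have "A *v z = (a *\<^sub>R Pr_par y + b *\<^sub>R Pr_perp y) *v z" for z
  proof -
    \<comment> \<open>Split \<open>z\<close> into its component along \<open>y\<close> and the rest;
      for \<open>y = 0\<close> division by zero gives \<open>t = 0\<close>.\<close>
    define t where "t = (y \<bullet> z) / (norm y)\<^sup>2"
    have "(z - t *\<^sub>R y) \<bullet> y = 0"
      by (cases "y = 0")
        (simp_all add: t_def inner_diff_left inner_diff_right power2_norm_eq_inner inner_commute)
    then have "A *v (z - t *\<^sub>R y) = b *\<^sub>R (z - t *\<^sub>R y)"
      by (rule b)
    then have "A *v z = t *\<^sub>R a *\<^sub>R y + b *\<^sub>R (z - t *\<^sub>R y)"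
      by (simp add: matrix_vector_mult_diff_distrib matrix_vector_mult_scaleR par algebra_simps)
    then show ?thesis
      by (simp add: matrix_vector_mult_add_rdistrib Pr_par_mult Pr_perp_mult t_def mult_ac
          flip: scaleR_matrix_vector_assoc)
  qed
  then have "A = a *\<^sub>R Pr_par y + b *\<^sub>R Pr_perp y"
    by (simp add: matrix_eq)
  then show thesis
    by (rule that)
qed

text \<open>Orthogonal matrices preserve inner products and norms, so conjugation by
  \<open>R\<close> carries the projections at \<open>y\<close> to those at \<open>R *v y\<close>.
  Both directions of the theorem use this.\<close>

lemma Pr_intertwines:
  fixes R :: "real ^ 'n ^ 'n"
  assumes "orthogonal_matrix R"
  shows "(a *\<^sub>R Pr_par (R *v y) + b *\<^sub>R Pr_perp (R *v y)) *v (R *v z)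
    = R *v ((a *\<^sub>R Pr_par y + b *\<^sub>R Pr_perp y) *v z)"
  using assms
  by (simp add: matrix_vector_mult_add_rdistrib Pr_par_mult Pr_perp_mult orthogonal_matrix_inner
      orthogonal_matrix_norm matrix_vector_right_distrib matrix_vector_mult_diff_distrib
      matrix_vector_mult_scaleR flip: scaleR_matrix_vector_assoc)

theorem lemma3p2:
  fixes k :: "real ^ 'd \<Rightarrow> real ^ 'd ^ 'd"
  assumes "CARD('d) \<ge> 2"
  shows "(\<forall>x. \<forall>R :: real ^ 'd ^ 'd. orthogonal_matrix R \<longrightarrow>
            k (- x) = transpose (k x) \<and> k (R *v x) = R ** k x ** matrix_inv R)
    \<longleftrightarrow>
         (\<exists>k\<^sub>0 :: real. k 0 = k\<^sub>0 *\<^sub>R mat 1) \<and>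
         (\<exists>k_par k_perp :: real \<Rightarrow> real. \<forall>x. x \<noteq> 0 \<longrightarrow>
            k x = k_par (norm x) *\<^sub>R Pr_par x + k_perp (norm x) *\<^sub>R Pr_perp x)"
  (is "?lhs \<longleftrightarrow> ?zero \<and> ?nonzero")
proof
  assume L: ?lhs
  have intertw: "k (R *v x) *v (R *v z) = R *v (k x *v z)" if "orthogonal_matrix R" for R x z
    using L that conj_eq_iff_intertwines[OF that] by blast
  \<comment> \<open>If \<open>R *v y = y\<close>, then \<open>intertw\<close> says exactly that
    \<open>k y\<close> commutes with \<open>R\<close>.\<close>
  have form: "\<exists>a b. k y = a *\<^sub>R Pr_par y + b *\<^sub>R Pr_perp y" for y
    using commutes_with_stabilizer[of y "k y"] intertw by metis
  have ?zero
    using form[of 0] by (auto simp: Pr_par_0 Pr_perp_eq)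
  moreover have ?nonzero
  proof -
    \<comment> \<open>One representative on each sphere about the origin, along an arbitrary
      coordinate axis; coefficients chosen there depend on the radius only.\<close>
    define e :: "real \<Rightarrow> real ^ 'd" where "e r = r *\<^sub>R axis undefined 1" for r
    have "\<forall>r. \<exists>a b. k (e r) = a *\<^sub>R Pr_par (e r) + b *\<^sub>R Pr_perp (e r)"
      using form by blast
    then obtain a b where ab: "k (e r) = a r *\<^sub>R Pr_par (e r) + b r *\<^sub>R Pr_perp (e r)" for r
      by metis
    have "k x = a (norm x) *\<^sub>R Pr_par x + b (norm x) *\<^sub>R Pr_perp x" for x
    proof -
      \<comment> \<open>The orthogonal group acts transitively on spheres, so some \<open>f\<close>
        moves the representative to \<open>x\<close>.\<close>
      have "norm (e (norm x)) = norm x"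
        by (simp add: e_def)
      then obtain f where f: "orthogonal_transformation f" "f (e (norm x)) = x"
        by (rule orthogonal_transformation_exists)
      define R where "R = matrix f"
      have R: "orthogonal_matrix R" "R *v e (norm x) = x"
        using f by (auto simp: R_def orthogonal_transformation_matrix matrix_works)
      have "k x = R ** k (e (norm x)) ** matrix_inv R"
        using L R by metis
      also have "\<dots> = a (norm x) *\<^sub>R Pr_par x + b (norm x) *\<^sub>R Pr_perp x"
        using Pr_intertwines[OF R(1), of _ "e (norm x)"] R(2)
        by (intro conj_eq_iff_intertwines[OF R(1), THEN iffD2, symmetric]) (simp add: ab)
      finally show ?thesis .
    qed
    then show ?thesis by blast
  qed
  ultimately show "?zero \<and> ?nonzero" ..
next
  assume "?zero \<and> ?nonzero"
  then obtain k\<^sub>0 p q where k0: "k 0 = k\<^sub>0 *\<^sub>R mat 1"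
    and pq: "\<And>x. x \<noteq> 0 \<Longrightarrow> k x = p (norm x) *\<^sub>R Pr_par x + q (norm x) *\<^sub>R Pr_perp x"
    by blast
  \<comment> \<open>\<open>Pr_par 0 = 0\<close> and \<open>Pr_perp 0 = mat 1\<close>, so one formula also covers the origin.\<close>
  define a b where "a = p(0 := k\<^sub>0)" and "b = q(0 := k\<^sub>0)"
  have k: "k x = a (norm x) *\<^sub>R Pr_par x + b (norm x) *\<^sub>R Pr_perp x" for x
    using k0 pq[of x] by (cases "x = 0") (simp_all add: a_def b_def Pr_perp_eq algebra_simps)
  have "k (- x) = transpose (k x)" for x
    by (simp add: k Pr_perp_eq Pr_par_minus transpose_Pr_par)
      (simp add: vec_eq_iff transpose_def Pr_par_def outer_def mult.commute mat_def)
  moreover have "k (R *v x) = R ** k x ** matrix_inv R" if "orthogonal_matrix R" for R x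
    using that Pr_intertwines[OF that]
    by (simp add: conj_eq_iff_intertwines k orthogonal_matrix_norm)
  ultimately show ?lhs by blast
qed

end
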